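(* Let $\{p_k\}_{k\in\mathbb{Z}}$ be a real sequence with $1<p^-\le p^+<\infty$, where $p^-:=\inf_{k}p_k$ and $p^+:=\sup_k p_k$; let $a,b:\mathbb{Z}\to(0,+\infty)$ and let $f_k:\mathbb{R}\to\mathbb{R}$, $k\in\mathbb{Z}$, be continuous, with $F_k(t):=\int_0^t f_k(s)\,ds$. Assume: (A) $b_k\to+\infty$ as $|k|\to\infty$; (F1) $f_k(0)=0$ for all $k\in\mathbb{Z}$; (F2) $\sum_{k\in\mathbb{Z}}\max_{|t|\le T}|f_k(t)|<\infty$ for every $T>0$; (F3) there exist sequences $\{c_n\}_{n\in\mathbb{N}},\{d_n\}_{n\in\mathbb{N}}$ such that $0<c_n<d_n<c_{n+1}$ for all $n$, $\lim_{n\to\infty}c_n=+\infty$, and $f_k(t)\le 0$ for every $k\in\mathbb{Z}$, $n\in\mathbb{N}$ and $t\in[c_n,d_n]$. Assume moreover that at least one of the following two conditions holds: (F5) $\displaystyle\max\left\{\limsup_{(k,t)\to(+\infty,+\infty)}\frac{F_k(t)}{(a_{k-1}+a_k+b_k)t^{p^+}},\ \limsup_{(k,t)\to(-\infty,+\infty)}\frac{F_k(t)}{(a_{k-1}+a_k+b_k)t^{p^+}}\right\}>\frac1{p^-}$; (F6) $\displaystyle\sup_{k\in\mathbb{Z}}\left(\limsup_{t\to+\infty}\frac{F_k(t)}{(a_{k-1}+a_k+b_k)t^{p^+}}\right)>\frac1{p^-}$. Then the problem $$-\nabla^-\left(a_k|\nabla^+u_k|^{p_k-2}\nabla^+u_k\right)+b_k|u_k|^{p_k-2}u_k=f_k(u_k)\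 \ (k\in\mathbb{Z}),\qquad u_k\to0\ \text{ as } |k|\to\infty,$$ possesses a sequence $\{u^n\}_{n\in\mathbb{N}}\subset E$ of positive solutions (i.e. $u^n_k>0$ for all $k\in\mathbb{Z}$) with $\|u^n\|_E\to+\infty$ as $n\to\infty$.
   Context: Notation: for $u:\mathbb{Z}\to\mathbb{R}$, $\nabla^-u_k=u_k-u_{k-1}$ and $\nabla^+u_k=u_{k+1}-u_k$; in particular $\nabla^-$ in the equation acts on the sequence $k\mapsto a_k|\nabla^+u_k|^{p_k-2}\nabla^+u_k$. The expression $|x|^{p-2}x$ is understood as $0$ at $x=0$. $l^{p_k}(\mathbb{Z})=\{u:\mathbb{Z}\to\mathbb{R}:\sum_{k\in\mathbb{Z}}|u_k|^{p_k}<\infty\}$, and $$E=\Big\{u\in l^{p_k}(\mathbb{Z}):\ \sum_{k\in\mathbb{Z}}\big(a_k|\nabla^+u_k|^{p_k}+b_k|u_k|^{p_k}\big)<\infty\Big\},$$ with norm $\|u\|_E=\inf\{\eta>0:\sum_{k\in\mathbb{Z}}(a_k|\nabla^+u_k/\eta|^{p_k}+b_k|u_k/\eta|^{p_k})\le1\}$. The limsup as $(k,t)\to(+\infty,+\infty)$ (resp. $(-\infty,+\infty)$) is the joint upper limit: $\lim_{N\to\infty}$ of the supremum over all integers $k\ge N$ (resp. $k\le -N$) and reals $t\ge N$. *)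

theory Defs
  imports "HOL-Analysis.Analysis"
begin

definition nabla_plus :: "(int \<Rightarrow> real) \<Rightarrow> int \<Rightarrow> real" where
  "nabla_plus u k = u (k + 1) - u k"

definition nabla_minus :: "(int \<Rightarrow> real) \<Rightarrow> int \<Rightarrow> real" where
  "nabla_minus u k = u k - u (k - 1)"

text \<open>The function \<open>x \<mapsto> |x|^(q-2) x\<close>; it vanishes at \<open>x = 0\<close> for every \<open>q\<close>.\<close>
definition phi :: "real \<Rightarrow> real \<Rightarrow> real" where
  "phi q x = \<bar>x\<bar> powr (q - 2) * x"

text \<open>The filter on the integers expressing \<open>|k| \<rightarrow> \<infinity>\<close>.\<close>
abbreviation abs_at_top :: "int filter" where
  "abs_at_top \<equiv> filtercomap (\<lambda>k. \<bar>k\<bar>) at_top"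

definition p_inf :: "(int \<Rightarrow> real) \<Rightarrow> real" where
  "p_inf p = (INF k. p k)"

definition p_sup :: "(int \<Rightarrow> real) \<Rightarrow> real" where
  "p_sup p = (SUP k. p k)"

text \<open>All series below have nonnegative terms, so \<open>summable_on\<close> expresses that the sum is finite.\<close>

definition lp_var :: "(int \<Rightarrow> real) \<Rightarrow> (int \<Rightarrow> real) set" where
  "lp_var p = {u. (\<lambda>k. \<bar>u k\<bar> powr p k) summable_on UNIV}"

definition modular_term ::
  "(int \<Rightarrow> real) \<Rightarrow> (int \<Rightarrow> real) \<Rightarrow> (int \<Rightarrow> real) \<Rightarrow> (int \<Rightarrow> real) \<Rightarrow> int \<Rightarrow> real" where
  "modular_term p a b u k = a k * \<bar>nabla_plus u k\<bar> powr p k + b k * \<bar>u k\<bar> powr p k"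

definition spaceE ::
  "(int \<Rightarrow> real) \<Rightarrow> (int \<Rightarrow> real) \<Rightarrow> (int \<Rightarrow> real) \<Rightarrow> (int \<Rightarrow> real) set" where
  "spaceE p a b = {u \<in> lp_var p. modular_term p a b u summable_on UNIV}"

text \<open>The summability condition is explicit because \<open>infsum\<close> is 0 on non-summable families.\<close>
definition normE ::
  "(int \<Rightarrow> real) \<Rightarrow> (int \<Rightarrow> real) \<Rightarrow> (int \<Rightarrow> real) \<Rightarrow> (int \<Rightarrow> real) \<Rightarrow> real" where
  "normE p a b u =
     Inf {\<eta>. \<eta> > 0 \<and>
       (\<lambda>k. a k * \<bar>nabla_plus u k / \<eta>\<bar> powr p k + b k * \<bar>u k / \<eta>\<bar> powr p k) summable_on UNIV \<and>
       (\<Sum>\<^sub>\<infinity>k. a k * \<bar>nabla_plus u k / \<eta>\<bar> powr p k + b k * \<bar>u k / \<eta>\<bar> powr p k) \<le> 1}"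

definition primitive :: "(int \<Rightarrow> real \<Rightarrow> real) \<Rightarrow> int \<Rightarrow> real \<Rightarrow> real" where
  "primitive f k t = (LBINT s=ereal 0..ereal t. f k s)"

definition growth_quotient ::
  "(int \<Rightarrow> real) \<Rightarrow> (int \<Rightarrow> real) \<Rightarrow> (int \<Rightarrow> real) \<Rightarrow> (int \<Rightarrow> real \<Rightarrow> real) \<Rightarrow> int \<Rightarrow> real \<Rightarrow> real" where
  "growth_quotient p a b f k t =
     primitive f k t / ((a (k - 1) + a k + b k) * t powr p_sup p)"

definition cond_F5 ::
  "(int \<Rightarrow> real) \<Rightarrow> (int \<Rightarrow> real) \<Rightarrow> (int \<Rightarrow> real) \<Rightarrow> (int \<Rightarrow> real \<Rightarrow> real) \<Rightarrow> bool" where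
  "cond_F5 p a b f \<longleftrightarrow>
     max (Limsup (at_top \<times>\<^sub>F at_top) (\<lambda>(k, t). ereal (growth_quotient p a b f k t)))
         (Limsup (at_bot \<times>\<^sub>F at_top) (\<lambda>(k, t). ereal (growth_quotient p a b f k t)))
       > ereal (1 / p_inf p)"

definition cond_F6 ::
  "(int \<Rightarrow> real) \<Rightarrow> (int \<Rightarrow> real) \<Rightarrow> (int \<Rightarrow> real) \<Rightarrow> (int \<Rightarrow> real \<Rightarrow> real) \<Rightarrow> bool" where
  "cond_F6 p a b f \<longleftrightarrow>
     (SUP k. Limsup at_top (\<lambda>t. ereal (growth_quotient p a b f k t))) > ereal (1 / p_inf p)"

definition is_solution ::
  "(int \<Rightarrow> real) \<Rightarrow> (int \<Rightarrow> real) \<Rightarrow> (int \<Rightarrow> real) \<Rightarrow> (int \<Rightarrow> real \<Rightarrow> real) \<Rightarrow> (int \<Rightarrow> real) \<Rightarrow> bool" where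
  "is_solution p a b f u \<longleftrightarrow>
     (\<forall>k. - nabla_minus (\<lambda>j. a j * phi (p j) (nabla_plus u j)) k + b k * phi (p k) (u k)
            = f k (u k)) \<and>
     (u \<longlongrightarrow> 0) abs_at_top"

end

theory Submission
  imports Defs
begin

text \<open>
  Fix \<open>d > 0\<close> with \<open>f k d \<le> 0\<close> for all \<open>k\<close> (for instance \<open>d = d\<^sub>n\<close>) and minimise the energy
  \<open>\<Sum>k. (a\<^sub>k |\<nabla>\<^sup>+u\<^sub>k|^p\<^sub>k + b\<^sub>k |u\<^sub>k|^p\<^sub>k) / p\<^sub>k - F\<^sub>k(u\<^sub>k)\<close> over the box \<open>{u. \<forall>k. 0 \<le> u\<^sub>k \<le> d}\<close>, which is
  compact in the product topology. Vary one coordinate of a minimiser: the one-sided derivative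
  rules out \<open>u\<^sub>k = d\<close> because \<open>f k d \<le> 0\<close>, and at \<open>u\<^sub>k = 0\<close> it forces both neighbours, hence
  all of \<open>u\<close>, to vanish. So a minimiser is either zero or a positive solution.
  By the growth condition, the spikes \<open>t e\<^sub>k\<close> have energies tending to \<open>-\<infinity>\<close>, so the
  minimal energies do so as \<open>d\<close> grows. Since \<open>b\<close> is bounded away from zero, a norm bound is a
  sup bound, and (F2) then bounds the energy below; hence the norms of the minimisers are unbounded.
\<close>

section \<open>Compactness and the direct method\<close>

lemma compact_PiE_UNIV:
  fixes K :: "'a \<Rightarrow> 'b::topological_space set"
  assumes "\<And>i. compact (K i)"
  shows "compact (PiE UNIV K)"
  using assms compactin_PiE[of "\<lambda>_. euclidean" UNIV K]
  by (simp add: euclidean_product_topology)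

text \<open>The infinite sum need not be continuous on \<open>K\<close>, but nonnegativity makes it
  lower semicontinuous. The competitor \<open>w\<close> gives the infimum a nonempty set of finite
  values, and the countable index type turns compactness into sequential compactness.\<close>

lemma infsum_attains_inf_on_compact:
  fixes g :: "'k \<Rightarrow> ('i::countable \<Rightarrow> real) \<Rightarrow> real"
  assumes K: "compact K"
    and nonneg: "\<And>k v. v \<in> K \<Longrightarrow> 0 \<le> g k v"
    and cont: "\<And>k. continuous_on K (g k)"
    and w: "w \<in> K" "(\<lambda>k. g k w) summable_on UNIV"
  obtains u where "u \<in> K" "(\<lambda>k. g k u) summable_on UNIV"
    "\<And>v. v \<in> K \<Longrightarrow> (\<lambda>k. g k v) summable_on UNIV \<Longrightarrow>
       (\<Sum>\<^sub>\<infinity>k. g k u) \<le> (\<Sum>\<^sub>\<infinity>k. g k v)"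
proof -
  define J where "J v = (\<Sum>\<^sub>\<infinity>k. g k v)" for v
  define D where "D = {v \<in> K. (\<lambda>k. g k v) summable_on UNIV}"
  define I where "I = Inf (J ` D)"
  have J0: "0 \<le> J v" if "v \<in> D" for v
    unfolding J_def using that nonneg by (auto simp: D_def intro!: infsum_nonneg)
  have bdd: "bdd_below (J ` D)"
    using J0 by (intro bdd_belowI2[of _ 0]) auto
  have ne: "J ` D \<noteq> {}"
    using w by (auto simp: D_def)
  have "\<exists>v. v \<in> D \<and> J v < I + 1 / Suc n" for n :: nat
    using cInf_lessD[OF ne, of "I + 1 / Suc n"] unfolding I_def by auto
  then obtain v where v: "\<And>n. v n \<in> D" "\<And>n. J (v n) < I + 1 / Suc n"
    by metis
  have "seq_compact K"
    using K by (simp add: compact_imp_seq_compact)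
  moreover have "\<forall>n. v n \<in> K"
    using v(1) by (auto simp: D_def)
  ultimately obtain u r where u: "u \<in> K" and r: "strict_mono (r :: nat \<Rightarrow> nat)"
    and lim: "(v \<circ> r) \<longlonglongrightarrow> u"
    unfolding seq_compact_def by metis
  have "(\<lambda>n. I + 1 / real (Suc n)) \<longlonglongrightarrow> I + 0"
    by (intro tendsto_intros LIMSEQ_Suc[OF lim_1_over_n])
  from LIMSEQ_subseq_LIMSEQ[OF this r]
  have lim_I: "(\<lambda>n. I + 1 / real (Suc (r n))) \<longlonglongrightarrow> I"
    by (simp add: o_def)
  \<comment> \<open>Only finite sums pass to the limit along the subsequence. The bound
    \<open>I\<close> is uniform in \<open>S\<close>, which yields both summability at
    \<open>u\<close> and minimality.\<close>
  have fin: "(\<Sum>k\<in>S. g k u) \<le> I" if "finite S" for S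
  proof (rule LIMSEQ_le[OF _ lim_I])
    have "(\<lambda>n. g k (v (r n))) \<longlonglongrightarrow> g k u" for k
      using continuous_on_tendsto_compose[OF cont lim u] v(1) by (auto simp: D_def o_def)
    then show "(\<lambda>n. \<Sum>k\<in>S. g k (v (r n))) \<longlonglongrightarrow> (\<Sum>k\<in>S. g k u)"
      by (intro tendsto_sum)
    have "(\<Sum>k\<in>S. g k (v n)) \<le> J (v n)" for n
      unfolding J_def using v(1)[of n] nonneg that
      by (intro finite_sum_le_infsum) (auto simp: D_def)
    then show "\<exists>N. \<forall>n\<ge>N. (\<Sum>k\<in>S. g k (v (r n))) \<le> I + 1 / real (Suc (r n))"
      using v(2) by (meson less_imp_le order_trans)
  qed
  have sm: "(\<lambda>k. g k u) summable_on UNIV"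
    using fin nonneg u by (intro nonneg_bdd_above_summable_on bdd_aboveI2[of _ _ I]) auto
  show thesis
  proof (rule that[OF u sm])
    fix w assume "w \<in> K" "(\<lambda>k. g k w) summable_on UNIV"
    then have "I \<le> J w"
      unfolding I_def by (intro cInf_lower bdd) (auto simp: D_def)
    with infsum_le_finite_sums[OF sm fin] show "(\<Sum>\<^sub>\<infinity>k. g k u) \<le> (\<Sum>\<^sub>\<infinity>k. g k w)"
      by (simp add: J_def)
  qed
qed

section \<open>One-variable calculus\<close>

text \<open>At \<open>x = 0\<close> the difference quotient is at most
  \<open>\<bar>h\<bar> powr (q - 1) / q\<close> in absolute value, which tends to 0 because
  \<open>q > 1\<close>.\<close>

lemma phi_powr_deriv:
  assumes "1 < q"
  shows "((\<lambda>x. \<bar>x\<bar> powr q / q) has_real_derivative phi q x) (at x)"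
proof (cases "x = 0")
  case True
  have "((\<lambda>h. \<bar>h\<bar> powr (q - 1)) \<longlongrightarrow> \<bar>0\<bar> powr (q - 1)) (at (0::real))"
    using assms by (intro tendsto_intros) auto
  then have "((\<lambda>h. \<bar>h\<bar> powr (q - 1) / q) \<longlongrightarrow> 0) (at (0::real))"
    using assms by (auto intro: tendsto_divide_zero)
  then have "((\<lambda>h. (\<bar>h\<bar> powr q / q) / h) \<longlongrightarrow> 0) (at (0::real))"
  proof (rule Lim_null_comparison[rotated])
    show "\<forall>\<^sub>F h in at (0::real). norm (\<bar>h\<bar> powr q / q / h) \<le> \<bar>h\<bar> powr (q - 1) / q"
      using assms by (intro always_eventually) (auto simp: powr_diff abs_mult mult.commute)
  qed
  then show ?thesis
    using True assms by (simp add: DERIV_def phi_def)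
next
  case False
  \<comment> \<open>Within distance \<open>\<bar>x\<bar>\<close> of \<open>x\<close> the sign is
    constant, so \<open>abs\<close> is linear there.\<close>
  have [derivative_intros]: "(abs has_real_derivative sgn x) (at x)"
  proof (rule has_field_derivative_transform_within)
    show "((\<lambda>y. sgn x * y) has_real_derivative sgn x) (at x)"
      by (auto intro!: derivative_eq_intros)
    show "sgn x * y = \<bar>y\<bar>" if "dist y x < \<bar>x\<bar>" for y
      using that by (auto simp: dist_real_def sgn_if abs_if split: if_splits)
  qed (use False in auto)
  have "((\<lambda>x. \<bar>x\<bar> powr q / q) has_real_derivative \<bar>x\<bar> powr (q - 1) * sgn x) (at x)"
    using False assms by (auto intro!: derivative_eq_intros simp: powr_diff)
  moreover have "\<bar>x\<bar> powr (q - 1) * sgn x = phi q x"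
  proof -
    have "\<bar>x\<bar> powr (q - 1) = \<bar>x\<bar> powr (q - 2) * \<bar>x\<bar> powr 1"
      by (subst powr_add[symmetric]) simp
    then show ?thesis by (simp add: phi_def sgn_if abs_if)
  qed
  ultimately show ?thesis by simp
qed

lemma phi_nonneg: "0 \<le> x \<Longrightarrow> 0 \<le> phi q x"
  and phi_pos: "0 < x \<Longrightarrow> 0 < phi q x"
  and phi_minus: "phi q (- x) = - phi q x"
  and phi_0 [simp]: "phi q 0 = 0"
  by (auto simp: phi_def)

text \<open>Kept as two one-sided statements, since a minimum at an endpoint yields just one of the
  inequalities.\<close>

lemma DERIV_min_on_interval:
  fixes \<psi> :: "real \<Rightarrow> real"
  assumes der: "(\<psi> has_real_derivative D) (at x)"
    and x: "x \<in> {l..r}" and min: "\<And>t. t \<in> {l..r} \<Longrightarrow> \<psi> x \<le> \<psi> t"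
  shows "x < r \<Longrightarrow> 0 \<le> D" and "l < x \<Longrightarrow> D \<le> 0"
proof -
  show "0 \<le> D" if "x < r"
  proof (rule ccontr)
    assume "\<not> 0 \<le> D"
    then obtain e where e: "e > 0" "\<And>h. 0 < h \<Longrightarrow> h < e \<Longrightarrow> \<psi> (x + h) < \<psi> x"
      using DERIV_neg_dec_right[OF der] by auto
    define h where "h = min (e / 2) (r - x)"
    have "0 < h" "h < e" "x + h \<in> {l..r}"
      using e x that by (auto simp: h_def)
    then show False using e(2) min by force
  qed
  show "D \<le> 0" if "l < x"
  proof (rule ccontr)
    assume "\<not> D \<le> 0"
    then obtain e where e: "e > 0" "\<And>h. 0 < h \<Longrightarrow> h < e \<Longrightarrow> \<psi> (x - h) < \<psi> x"
      using DERIV_pos_inc_left[OF der] by auto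
    define h where "h = min (e / 2) (x - l)"
    have "0 < h" "h < e" "x - h \<in> {l..r}"
      using e x that by (auto simp: h_def)
    then show False using e(2) min by force
  qed
qed

section \<open>Infinite sums and the filter at infinity\<close>

text \<open>The difference of \<open>h\<close> and \<open>g\<close> is supported in
  \<open>S\<close>, hence has a finite sum. This serves to compare energies after a change of one
  coordinate.\<close>

lemma infsum_finite_modification:
  fixes g h :: "'k \<Rightarrow> real"
  assumes g: "g summable_on UNIV" and S: "finite S" and eq: "\<And>k. k \<notin> S \<Longrightarrow> h k = g k"
  shows "h summable_on UNIV"
    and "(\<Sum>\<^sub>\<infinity>k. h k) = (\<Sum>\<^sub>\<infinity>k. g k) + (\<Sum>k\<in>S. h k - g k)"
proof -
  have "((\<lambda>k. h k - g k) has_sum (\<Sum>k\<in>S. h k - g k)) UNIV"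
    using S eq by (intro has_sum_finite_neutralI[of S]) auto
  with g have "((\<lambda>k. g k + (h k - g k)) has_sum ((\<Sum>\<^sub>\<infinity>k. g k) + (\<Sum>k\<in>S. h k - g k))) UNIV"
    by (intro has_sum_add) auto
  then show "h summable_on UNIV"
    and "(\<Sum>\<^sub>\<infinity>k. h k) = (\<Sum>\<^sub>\<infinity>k. g k) + (\<Sum>k\<in>S. h k - g k)"
    by (auto simp: summable_on_def infsumI)
qed

lemma eventually_abs_at_top_iff:
  "eventually P abs_at_top \<longleftrightarrow> (\<exists>N. \<forall>k. N \<le> \<bar>k\<bar> \<longrightarrow> P k)"
  by (auto simp: eventually_filtercomap eventually_at_top_linorder)

text \<open>Every \<open>{-N..N}\<close> is finite and every finite set of integers lies in such an
  interval, so this is the cofinite filter.\<close>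

lemma eventually_abs_at_top_iff_finite:
  "eventually P abs_at_top \<longleftrightarrow> finite {k. \<not> P k}"
proof
  assume "eventually P abs_at_top"
  then obtain N where "\<And>k. N \<le> \<bar>k\<bar> \<Longrightarrow> P k"
    by (auto simp: eventually_abs_at_top_iff)
  then have "{k. \<not> P k} \<subseteq> {-N..N}"
    by (smt (verit) atLeastAtMost_iff mem_Collect_eq subsetI)
  then show "finite {k. \<not> P k}"
    using finite_subset by blast
next
  assume fin: "finite {k. \<not> P k}"
  define N where "N = Max (insert 0 (abs ` {k. \<not> P k}))"
  have N: "\<bar>k\<bar> \<le> N" if "\<not> P k" for k
    unfolding N_def using that fin by (intro Max_ge) auto
  have "P k" if "N + 1 \<le> \<bar>k\<bar>" for k
    using N[of k] that by linarith
  then show "eventually P abs_at_top"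
    unfolding eventually_abs_at_top_iff by blast
qed

lemma frequently_gt_if_Limsup_gt:
  fixes X :: "'a \<Rightarrow> ereal"
  assumes "L < Limsup F X"
  shows "\<exists>\<^sub>F x in F. L < X x"
  using assms Limsup_bounded[of X L F]
  by (auto simp: frequently_def not_less)

text \<open>Counting: \<open>n\<close> indices in the set contribute at least
  \<open>n * \<epsilon>\<close>, and \<open>n\<close> is chosen so that this exceeds the whole
  sum.\<close>

lemma summable_on_finite_superlevel:
  fixes g :: "'k \<Rightarrow> real"
  assumes "g summable_on UNIV" "\<And>k. 0 \<le> g k" "0 < \<epsilon>"
  shows "finite {k. \<epsilon> \<le> g k}"
proof (rule ccontr)
  assume inf: "infinite {k. \<epsilon> \<le> g k}"
  define n where "n = nat \<lceil>infsum g UNIV / \<epsilon>\<rceil> + 1"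
  obtain S where S: "finite S" "card S = n" "S \<subseteq> {k. \<epsilon> \<le> g k}"
    using infinite_arbitrarily_large[OF inf] by metis
  have "real n * \<epsilon> \<le> sum g S"
    using sum_mono[of S "\<lambda>_. \<epsilon>" g] S by auto
  also have "\<dots> \<le> infsum g UNIV"
    using assms S by (intro finite_sum_le_infsum) auto
  also have "infsum g UNIV < real n * \<epsilon>"
  proof -
    have "infsum g UNIV / \<epsilon> < real n" unfolding n_def by linarith
    then show ?thesis using assms by (simp add: field_simps)
  qed
  finally show False by simp
qed

section \<open>The setting, the energy and bounds on the data\<close>

text \<open>The standing hypotheses; the sign and growth conditions on \<open>f\<close> are assumed
  in the lemmas where they enter.\<close>

locale anisotropic_difference_problem =
  fixes p a b :: "int \<Rightarrow> real" and f :: "int \<Rightarrow> real \<Rightarrow> real"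
  assumes p_bdd: "bdd_below (range p)" "bdd_above (range p)"
    and p_inf_gt_1: "1 < p_inf p"
    and a_pos: "\<And>k. 0 < a k"
    and b_pos: "\<And>k. 0 < b k"
    and f_cont: "\<And>k. continuous_on UNIV (f k)"
    and b_at_top: "filterlim b at_top abs_at_top"
    and f_0: "\<And>k. f k 0 = 0"
    and f_summable: "\<And>T. T > 0 \<Longrightarrow> (\<lambda>k. SUP t\<in>{t. \<bar>t\<bar> \<le> T}. \<bar>f k t\<bar>) summable_on UNIV"
begin

definition f_sup :: "real \<Rightarrow> int \<Rightarrow> real" where
  "f_sup T k = (SUP t\<in>{t. \<bar>t\<bar> \<le> T}. \<bar>f k t\<bar>)"

text \<open>Adding the constant \<open>d * f_sup d k\<close> makes every term nonnegative on the box, so that the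
  total energy is lower semicontinuous there by Fatou's lemma.\<close>
definition energy_term :: "real \<Rightarrow> int \<Rightarrow> (int \<Rightarrow> real) \<Rightarrow> real" where
  "energy_term d k u = modular_term p a b u k / p k + (d * f_sup d k - primitive f k (u k))"

definition order_box :: "real \<Rightarrow> (int \<Rightarrow> real) set" where
  "order_box d = PiE UNIV (\<lambda>_. {0..d})"

text \<open>The difference of the two sides of the equation, which is also the partial derivative of
  the energy in the coordinate \<open>u k\<close>.\<close>

definition residual :: "(int \<Rightarrow> real) \<Rightarrow> int \<Rightarrow> real" where
  "residual u k = - nabla_minus (\<lambda>j. a j * phi (p j) (nabla_plus u j)) k
     + b k * phi (p k) (u k) - f k (u k)"

lemma p_bounds: "p_inf p \<le> p k" "p k \<le> p_sup p"
  using p_bdd by (auto simp: p_inf_def p_sup_def intro: cINF_lower cSUP_upper)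

lemma p_gt_1: "1 < p k"
  using p_bounds(1)[of k] p_inf_gt_1 by linarith

lemma p_pos: "0 < p k"
  using p_gt_1[of k] by linarith

text \<open>Continuity on the compact interval \<open>{-T..T}\<close> bounds the set of values, so
  \<open>SUP\<close> is a true supremum.\<close>

lemma f_le_f_sup: "\<bar>t\<bar> \<le> T \<Longrightarrow> \<bar>f k t\<bar> \<le> f_sup T k"
proof -
  assume t: "\<bar>t\<bar> \<le> T"
  have "{t. \<bar>t\<bar> \<le> T} = {-T..T}" by auto
  moreover have "compact ((\<lambda>t. \<bar>f k t\<bar>) ` {-T..T})"
    by (intro compact_continuous_image continuous_intros continuous_on_subset[OF f_cont]) auto
  ultimately have "bdd_above ((\<lambda>t. \<bar>f k t\<bar>) ` {t. \<bar>t\<bar> \<le> T})"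
    by (simp add: compact_imp_bounded bounded_imp_bdd_above)
  then show ?thesis
    unfolding f_sup_def using t by (intro cSUP_upper) auto
qed

lemma f_sup_summable: "T > 0 \<Longrightarrow> f_sup T summable_on UNIV"
  using f_summable[of T] by (simp add: f_sup_def[abs_def])

lemma f_sup_nonneg: "0 \<le> T \<Longrightarrow> 0 \<le> f_sup T k"
  using f_le_f_sup[of 0 T k] by simp

lemma primitive_0 [simp]: "primitive f k 0 = 0"
  by (simp add: primitive_def)

lemma primitive_deriv: "(primitive f k has_real_derivative f k t) (at t)"
proof -
  \<comment> \<open>The margin of 1 on both sides puts \<open>t\<close> in the interior, so the
    derivative within the interval is a full derivative.\<close>
  have "((\<lambda>u. LBINT y=0..u. f k y) has_vector_derivative f k t)
      (at t within {min 0 t - 1..max 0 t + 1})"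
    unfolding zero_ereal_def
    by (intro interval_integral_FTC2 continuous_on_subset[OF f_cont]) auto
  moreover have "at t within {min 0 t - 1..max 0 t + 1} = at t"
    by (intro at_within_interior) (auto simp: interior_cbox[where 'a=real, unfolded box_real cbox_interval])
  ultimately show ?thesis
    by (simp add: primitive_def[abs_def] zero_ereal_def
        has_real_derivative_iff_has_vector_derivative)
qed

text \<open>By the mean value theorem \<open>primitive f k t\<close> equals \<open>t * f k z\<close>
  for some \<open>z\<close> between 0 and \<open>t\<close>. With \<open>T = d\<close> this makes the
  shifted potential in \<open>energy_term\<close> nonnegative.\<close>

lemma primitive_le:
  assumes "0 \<le> t" "t \<le> T"
  shows "primitive f k t \<le> T * f_sup T k"
proof (cases "t = 0")
  case True
  then show ?thesis using assms f_sup_nonneg[of T k] by simp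
next
  case False
  then have "0 < t" using assms by simp
  then obtain z where z: "0 < z" "z < t" "primitive f k t - primitive f k 0 = (t - 0) * f k z"
    using MVT2[of 0 t "primitive f k" "f k"] primitive_deriv by blast
  have "f k z \<le> f_sup T k"
    using f_le_f_sup[of z T k] z assms by auto
  then have "t * f k z \<le> t * f_sup T k"
    using assms by (intro mult_left_mono) auto
  also have "\<dots> \<le> T * f_sup T k"
    using assms f_sup_nonneg[of T k] by (intro mult_right_mono) auto
  finally show ?thesis using z by simp
qed

section \<open>The energy on the box and its minimiser\<close>

lemma modular_term_nonneg: "0 \<le> modular_term p a b u k"
  using a_pos[of k] b_pos[of k] by (simp add: modular_term_def)

lemma mem_order_box_iff: "u \<in> order_box d \<longleftrightarrow> (\<forall>k. 0 \<le> u k \<and> u k \<le> d)"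
  by (auto simp: order_box_def)

lemma energy_term_nonneg:
  assumes "u \<in> order_box d"
  shows "0 \<le> energy_term d k u"
  using assms primitive_le[of "u k" d k] modular_term_nonneg[of u k] p_pos[of k]
  by (simp add: energy_term_def mem_order_box_iff)

text \<open>The factor \<open>p_sup p\<close> does not depend on \<open>k\<close>, so summability
  passes from the energy to the modular.\<close>

lemma modular_le_energy_term:
  assumes "u \<in> order_box d"
  shows "modular_term p a b u k \<le> p_sup p * energy_term d k u"
proof -
  have "modular_term p a b u k / p k \<le> energy_term d k u"
    using assms primitive_le[of "u k" d k] by (simp add: energy_term_def mem_order_box_iff)
  then have "modular_term p a b u k \<le> p k * energy_term d k u"
    using p_pos[of k] by (simp add: field_simps)
  also have "\<dots> \<le> p_sup p * energy_term d k u"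
    by (intro mult_right_mono p_bounds energy_term_nonneg assms)
  finally show ?thesis .
qed

lemma energy_term_continuous: "continuous_on (order_box d) (energy_term d k)"
proof -
  have [continuous_intros]: "continuous_on (order_box d) (\<lambda>u. u j)" for j :: int
    by (rule continuous_on_subset[OF continuous_on_product_coordinates]) simp
  have "continuous_on UNIV (primitive f k)"
    using primitive_deriv DERIV_isCont by (blast intro: continuous_at_imp_continuous_on)
  then have [continuous_intros]: "continuous_on (order_box d) (\<lambda>u. primitive f k (u k))"
    by (rule continuous_on_compose2) (auto intro: continuous_intros)
  have [continuous_intros]: "continuous_on (order_box d) (\<lambda>u. \<bar>h u\<bar> powr p k)"
    if "continuous_on (order_box d) h" for h
    using that p_pos[of k] by (intro continuous_on_powr' continuous_intros) auto
  show ?thesis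
    unfolding energy_term_def[abs_def] modular_term_def nabla_plus_def
    using p_pos[of k] by (intro continuous_intros) auto
qed

lemma energy_term_0: "energy_term d k (\<lambda>_. 0) = d * f_sup d k"
  by (simp add: energy_term_def modular_term_def nabla_plus_def)

text \<open>The zero sequence is a competitor of finite energy by (F2).\<close>

lemma energy_minimizer:
  assumes "0 < d"
  obtains u where "u \<in> order_box d" "(\<lambda>k. energy_term d k u) summable_on UNIV"
    "\<And>v. v \<in> order_box d \<Longrightarrow> (\<lambda>k. energy_term d k v) summable_on UNIV \<Longrightarrow>
       (\<Sum>\<^sub>\<infinity>k. energy_term d k u) \<le> (\<Sum>\<^sub>\<infinity>k. energy_term d k v)"
proof -
  have "compact (order_box d)"
    unfolding order_box_def by (intro compact_PiE_UNIV) auto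
  moreover have "(\<lambda>_. 0) \<in> order_box d"
    using assms by (simp add: mem_order_box_iff)
  moreover have "(\<lambda>k. energy_term d k (\<lambda>_. 0)) summable_on UNIV"
    using f_sup_summable[OF assms] by (simp add: energy_term_0 summable_on_cmult_right)
  ultimately show thesis
    using infsum_attains_inf_on_compact[of "order_box d" "energy_term d" "\<lambda>_. 0"]
      energy_term_nonneg energy_term_continuous that by metis
qed

section \<open>Variation of a single coordinate\<close>

text \<open>The value \<open>u k\<close> enters only term \<open>k\<close> and, through the forward
  difference, term \<open>k - 1\<close>.\<close>

lemma energy_update:
  assumes "(\<lambda>k. energy_term d k u) summable_on UNIV"
  shows "(\<lambda>j. energy_term d j (u(k := t))) summable_on UNIV"
    and "(\<Sum>\<^sub>\<infinity>j. energy_term d j (u(k := t))) = (\<Sum>\<^sub>\<infinity>j. energy_term d j u)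
      + (energy_term d (k - 1) (u(k := t)) + energy_term d k (u(k := t)))
      - (energy_term d (k - 1) u + energy_term d k u)"
proof -
  have eq: "energy_term d j (u(k := t)) = energy_term d j u" if "j \<notin> {k - 1, k}" for j
    using that by (auto simp: energy_term_def modular_term_def nabla_plus_def)
  show "(\<lambda>j. energy_term d j (u(k := t))) summable_on UNIV"
    by (rule infsum_finite_modification(1)[where S = "{k - 1, k}", OF assms _ eq]) simp_all
  show "(\<Sum>\<^sub>\<infinity>j. energy_term d j (u(k := t))) = (\<Sum>\<^sub>\<infinity>j. energy_term d j u)
      + (energy_term d (k - 1) (u(k := t)) + energy_term d k (u(k := t)))
      - (energy_term d (k - 1) u + energy_term d k u)"
    by (subst infsum_finite_modification(2)[where S = "{k - 1, k}", OF assms _ eq]) simp_all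
qed

lemma energy_update_deriv:
  "((\<lambda>t. energy_term d (k - 1) (u(k := t)) + energy_term d k (u(k := t)))
     has_real_derivative residual u k) (at (u k))"
proof -
  have left: "((\<lambda>t. a (k - 1) * (\<bar>t - u (k - 1)\<bar> powr p (k - 1) / p (k - 1)))
      has_real_derivative a (k - 1) * phi (p (k - 1)) (u k - u (k - 1))) (at (u k))"
    by (intro DERIV_cmult DERIV_chain2[OF phi_powr_deriv[OF p_gt_1], THEN DERIV_cong])
      (auto intro!: derivative_eq_intros)
  have right: "((\<lambda>t. a k * (\<bar>u (k + 1) - t\<bar> powr p k / p k))
      has_real_derivative - (a k * phi (p k) (u (k + 1) - u k))) (at (u k))"
    unfolding mult_minus_right[symmetric]
    by (intro DERIV_cmult DERIV_chain2[OF phi_powr_deriv[OF p_gt_1], THEN DERIV_cong])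
      (auto intro!: derivative_eq_intros)
  have mid: "((\<lambda>t. b k * (\<bar>t\<bar> powr p k / p k))
      has_real_derivative b k * phi (p k) (u k)) (at (u k))"
    by (intro DERIV_cmult phi_powr_deriv p_gt_1)
  \<comment> \<open>Everything in the two terms that is independent of \<open>t\<close>.\<close>
  define c where "c = b (k - 1) * \<bar>u (k - 1)\<bar> powr p (k - 1) / p (k - 1)
    + (d * f_sup d (k - 1) - primitive f (k - 1) (u (k - 1))) + d * f_sup d k"
  have "energy_term d (k - 1) (u(k := t)) + energy_term d k (u(k := t)) =
      a (k - 1) * (\<bar>t - u (k - 1)\<bar> powr p (k - 1) / p (k - 1))
      + a k * (\<bar>u (k + 1) - t\<bar> powr p k / p k)
      + b k * (\<bar>t\<bar> powr p k / p k) - primitive f k t + c" for t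
    by (simp add: energy_term_def modular_term_def nabla_plus_def c_def add_divide_distrib)
  moreover have "((\<lambda>t. a (k - 1) * (\<bar>t - u (k - 1)\<bar> powr p (k - 1) / p (k - 1))
      + a k * (\<bar>u (k + 1) - t\<bar> powr p k / p k)
      + b k * (\<bar>t\<bar> powr p k / p k) - primitive f k t + c) has_real_derivative
      a (k - 1) * phi (p (k - 1)) (u k - u (k - 1)) + - (a k * phi (p k) (u (k + 1) - u k))
      + b k * phi (p k) (u k) - f k (u k) + 0) (at (u k))"
    by (intro DERIV_add DERIV_diff left right mid primitive_deriv DERIV_const)
  ultimately show ?thesis
    by (simp add: residual_def nabla_minus_def nabla_plus_def)
qed

text \<open>All but finitely many \<open>b k\<close> are at least 1, and the remaining ones are
  positive. The cap \<open>\<beta> \<le> 1\<close> serves the norm estimate below.\<close>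

lemma b_lower_bound:
  obtains \<beta> where "0 < \<beta>" "\<beta> \<le> 1" "\<And>k. \<beta> \<le> b k"
proof -
  have "eventually (\<lambda>k. 1 \<le> b k) abs_at_top"
    using b_at_top by (simp add: filterlim_at_top)
  then have fin: "finite {k. \<not> 1 \<le> b k}"
    by (simp only: eventually_abs_at_top_iff_finite)
  define \<beta> where "\<beta> = Min (insert 1 (b ` {k. \<not> 1 \<le> b k}))"
  show thesis
  proof
    show "0 < \<beta>" "\<beta> \<le> 1"
      using fin b_pos by (auto simp: \<beta>_def)
    show "\<beta> \<le> b k" for k
    proof (cases "1 \<le> b k")
      case True
      with \<open>\<beta> \<le> 1\<close> show ?thesis by linarith
    next
      case False
      then show ?thesis unfolding \<beta>_def using fin by (intro Min_le) auto
    qed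
  qed
qed

text \<open>A coordinate below \<open>d\<close> may be raised and a positive one lowered without
  leaving the box; each move gives one inequality.\<close>

lemma energy_minimizer_residual:
  assumes u: "u \<in> order_box d" and sm: "(\<lambda>k. energy_term d k u) summable_on UNIV"
    and min: "\<And>v. v \<in> order_box d \<Longrightarrow> (\<lambda>k. energy_term d k v) summable_on UNIV \<Longrightarrow>
       (\<Sum>\<^sub>\<infinity>k. energy_term d k u) \<le> (\<Sum>\<^sub>\<infinity>k. energy_term d k v)"
  shows "u k < d \<Longrightarrow> 0 \<le> residual u k" and "0 < u k \<Longrightarrow> residual u k \<le> 0"
proof -
  define \<psi> where "\<psi> t = energy_term d (k - 1) (u(k := t)) + energy_term d k (u(k := t))" for t
  have der: "(\<psi> has_real_derivative residual u k) (at (u k))"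
    unfolding \<psi>_def[abs_def] by (rule energy_update_deriv)
  have mem: "u k \<in> {0..d}"
    using u by (simp add: mem_order_box_iff)
  have \<psi>_min: "\<psi> (u k) \<le> \<psi> t" if "t \<in> {0..d}" for t
  proof -
    have "u(k := t) \<in> order_box d"
      using that u by (simp add: mem_order_box_iff)
    from min[OF this energy_update(1)[OF sm]] show ?thesis
      by (simp add: energy_update(2)[OF sm] \<psi>_def)
  qed
  show "u k < d \<Longrightarrow> 0 \<le> residual u k" and "0 < u k \<Longrightarrow> residual u k \<le> 0"
    using DERIV_min_on_interval[OF der mem \<psi>_min] by blast+
qed

text \<open>Since \<open>phi\<close> is odd, both differences can be written as \<open>u k\<close>
  minus a neighbour, so their signs are visible when \<open>u k\<close> is 0 or
  \<open>d\<close>.\<close>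

lemma residual_alt:
  "residual u k = a (k - 1) * phi (p (k - 1)) (u k - u (k - 1))
     + a k * phi (p k) (u k - u (k + 1)) + b k * phi (p k) (u k) - f k (u k)"
  using phi_minus[of "p k" "u (k + 1) - u k"]
  by (simp add: residual_def nabla_minus_def nabla_plus_def)

lemma energy_minimizer_cases:
  assumes d: "0 < d" "\<And>k. f k d \<le> 0"
    and u: "u \<in> order_box d" and sm: "(\<lambda>k. energy_term d k u) summable_on UNIV"
    and min: "\<And>v. v \<in> order_box d \<Longrightarrow> (\<lambda>k. energy_term d k v) summable_on UNIV \<Longrightarrow>
       (\<Sum>\<^sub>\<infinity>k. energy_term d k u) \<le> (\<Sum>\<^sub>\<infinity>k. energy_term d k v)"
  shows "u = (\<lambda>_. 0) \<or> ((\<forall>k. 0 < u k) \<and> (\<forall>k. residual u k = 0))"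
proof -
  have var: "u k < d \<Longrightarrow> 0 \<le> residual u k" "0 < u k \<Longrightarrow> residual u k \<le> 0" for k
    using energy_minimizer_residual[OF u sm] min by blast+
  have range: "0 \<le> u k" "u k \<le> d" for k
    using u by (auto simp: mem_order_box_iff)
  have less_d: "u k < d" for k
  proof (rule ccontr)
    assume "\<not> u k < d"
    then have eq: "u k = d" using range[of k] by simp
    \<comment> \<open>No neighbour exceeds \<open>d\<close>, so every summand of
      \<open>residual_alt\<close> is nonnegative and the \<open>b\<close> term is positive.\<close>
    have "0 \<le> a (k - 1) * phi (p (k - 1)) (d - u (k - 1))"
      "0 \<le> a k * phi (p k) (d - u (k + 1))" "0 < b k * phi (p k) d"
      using range a_pos b_pos d(1) by (simp_all add: phi_nonneg phi_pos less_imp_le[OF a_pos])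
    then have "0 < residual u k"
      unfolding residual_alt eq using d(2)[of k] by linarith
    with var(2)[of k] show False using eq d(1) by simp
  qed
  have nbr: "u (k - 1) = 0 \<and> u (k + 1) = 0" if "u k = 0" for k
  proof -
    \<comment> \<open>At a zero of \<open>u\<close> the residual is minus a sum of nonnegative
      terms; as it is also nonnegative, both terms vanish.\<close>
    have "residual u k = - (a (k - 1) * phi (p (k - 1)) (u (k - 1)) + a k * phi (p k) (u (k + 1)))"
      unfolding residual_alt using that by (simp add: phi_minus f_0)
    with var(1)[OF less_d, of k]
    have le: "a (k - 1) * phi (p (k - 1)) (u (k - 1)) + a k * phi (p k) (u (k + 1)) \<le> 0"
      by simp
    have "0 \<le> a (k - 1) * phi (p (k - 1)) (u (k - 1))" "0 \<le> a k * phi (p k) (u (k + 1))"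
      using range a_pos by (simp_all add: phi_nonneg less_imp_le[OF a_pos])
    moreover have "0 < a (k - 1) * phi (p (k - 1)) (u (k - 1))" if "0 < u (k - 1)"
      using that a_pos phi_pos by simp
    moreover have "0 < a k * phi (p k) (u (k + 1))" if "0 < u (k + 1)"
      using that a_pos phi_pos by simp
    ultimately show ?thesis
      using le range[of "k - 1"] range[of "k + 1"] by linarith
  qed
  show ?thesis
  proof (cases "\<exists>k. u k = 0")
    case True
    then obtain k0 where "u k0 = 0" by blast
    then have "u k = 0" for k
      by (induction k rule: int_induct[where k = k0]) (use nbr in auto)
    then show ?thesis by auto
  next
    case False
    then have pos: "0 < u k" for k
      using range(1)[of k] by (metis order_le_less)
    with var less_d have "residual u k = 0" for k
      by (meson antisym)
    with pos show ?thesis by blast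
  qed
qed

section \<open>Membership in \<open>spaceE\<close>, decay and the norm\<close>

text \<open>The energy controls the modular, and the modular controls
  \<open>\<bar>u k\<bar> powr p k\<close> up to the factor \<open>1 / \<beta>\<close>.\<close>

lemma finite_energy_imp_spaceE:
  assumes "u \<in> order_box d" "(\<lambda>k. energy_term d k u) summable_on UNIV"
  shows "u \<in> spaceE p a b"
proof -
  have sm: "modular_term p a b u summable_on UNIV"
    using assms(2) modular_le_energy_term[OF assms(1)] modular_term_nonneg
    by (intro summable_on_comparison_test[OF summable_on_cmult_right[OF assms(2), of "p_sup p"]]) auto
  obtain \<beta> where \<beta>: "0 < \<beta>" "\<And>k. \<beta> \<le> b k"
    using b_lower_bound by metis
  have "\<bar>u k\<bar> powr p k \<le> 1 / \<beta> * modular_term p a b u k" for k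
  proof -
    have "\<beta> * \<bar>u k\<bar> powr p k \<le> b k * \<bar>u k\<bar> powr p k"
      using \<beta> by (intro mult_right_mono) auto
    also have "\<dots> \<le> modular_term p a b u k"
      using a_pos[of k] by (simp add: modular_term_def)
    finally show ?thesis using \<beta> by (simp add: field_simps)
  qed
  then have "u \<in> lp_var p"
    unfolding lp_var_def mem_Collect_eq
    by (intro summable_on_comparison_test[OF summable_on_cmult_right[OF sm, of "1 / \<beta>"]]) auto
  with sm show ?thesis by (simp add: spaceE_def)
qed

lemma lp_var_tendsto_0:
  assumes "u \<in> lp_var p"
  shows "(u \<longlongrightarrow> 0) abs_at_top"
proof (rule tendstoI)
  fix e :: real assume e: "0 < e"
  \<comment> \<open>For a base at most 1 the largest exponent gives the smallest power, so
    \<open>\<epsilon> powr p_sup p\<close> is a threshold valid for all \<open>k\<close>.\<close>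
  define \<epsilon> where "\<epsilon> = min e 1"
  have \<epsilon>: "0 < \<epsilon>" "\<epsilon> \<le> 1" "\<epsilon> \<le> e" using e by (auto simp: \<epsilon>_def)
  have "\<epsilon> powr p_sup p \<le> \<bar>u k\<bar> powr p k" if "e \<le> \<bar>u k\<bar>" for k
  proof -
    have "\<epsilon> powr p_sup p \<le> \<epsilon> powr p k"
      using \<epsilon> p_bounds(2)[of k] by (intro powr_mono') auto
    also have "\<dots> \<le> \<bar>u k\<bar> powr p k"
      using \<epsilon> that p_pos[of k] by (intro powr_mono2) auto
    finally show ?thesis .
  qed
  then have "{k. \<not> dist (u k) 0 < e} \<subseteq> {k. \<epsilon> powr p_sup p \<le> \<bar>u k\<bar> powr p k}"
    by auto
  moreover have "finite {k. \<epsilon> powr p_sup p \<le> \<bar>u k\<bar> powr p k}"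
    using assms \<epsilon>(1) by (intro summable_on_finite_superlevel) (auto simp: lp_var_def)
  ultimately show "eventually (\<lambda>k. dist (u k) 0 < e) abs_at_top"
    unfolding eventually_abs_at_top_iff_finite by (rule finite_subset)
qed

lemma normE_set_eq:
  "(\<lambda>k. a k * \<bar>nabla_plus u k / \<eta>\<bar> powr p k + b k * \<bar>u k / \<eta>\<bar> powr p k)
     = modular_term p a b (\<lambda>k. u k / \<eta>)"
  by (simp add: fun_eq_iff modular_term_def nabla_plus_def diff_divide_distrib)

text \<open>Some \<open>\<eta> < R\<close> has modular of \<open>u / \<eta>\<close> at most 1, and
  each single term of it bounds one coordinate.\<close>

lemma normE_less_imp_coordinate_bound:
  assumes u: "u \<in> spaceE p a b" and norm: "normE p a b u < R"
    and \<beta>: "0 < \<beta>" "\<beta> \<le> 1" "\<And>k. \<beta> \<le> b k"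
  shows "\<bar>u k\<bar> \<le> R / \<beta>"
proof -
  let ?m = "modular_term p a b"
  define N where "N = {\<eta>. \<eta> > 0 \<and> ?m (\<lambda>k. u k / \<eta>) summable_on UNIV \<and> infsum (?m (\<lambda>k. u k / \<eta>)) UNIV \<le> 1}"
  have norm_eq: "normE p a b u = Inf N"
    unfolding normE_def normE_set_eq N_def ..
  have sm: "?m u summable_on UNIV"
    using u by (simp add: spaceE_def)
  \<comment> \<open>A witness that \<open>N\<close> is nonempty, which the extraction of
    \<open>\<eta>\<close> from \<open>Inf N\<close> requires. As \<open>\<rho> \<ge> 1\<close> and
    the exponents exceed 1, scaling by \<open>1 / \<rho>\<close> shrinks the modular at least by
    that factor.\<close>
  define \<rho> where "\<rho> = max 1 (infsum (?m u) UNIV)"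
  have \<rho>: "1 \<le> \<rho>" by (simp add: \<rho>_def)
  have le: "?m (\<lambda>k. u k / \<rho>) j \<le> 1 / \<rho> * ?m u j" for j
  proof -
    have "\<bar>x / \<rho>\<bar> powr p j \<le> 1 / \<rho> * \<bar>x\<bar> powr p j" for x
    proof -
      have "\<rho> powr 1 \<le> \<rho> powr p j"
        using \<rho> p_gt_1[of j] by (intro powr_mono) auto
      then have "\<bar>x\<bar> powr p j / \<rho> powr p j \<le> \<bar>x\<bar> powr p j / \<rho>"
        using \<rho> by (intro divide_left_mono) auto
      then show ?thesis using \<rho> by (simp add: abs_divide powr_divide)
    qed
    from add_mono[OF mult_left_mono[OF this, of "a j" "nabla_plus u j"] mult_left_mono[OF this, of "b j" "u j"]]
    show ?thesis
      using a_pos[of j] b_pos[of j]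
      by (simp add: modular_term_def nabla_plus_def diff_divide_distrib distrib_left mult.left_commute)
  qed
  have sm': "?m (\<lambda>k. u k / \<rho>) summable_on UNIV"
    using le modular_term_nonneg
    by (intro summable_on_comparison_test[OF summable_on_cmult_right[OF sm, of "1 / \<rho>"]]) auto
  have "infsum (?m (\<lambda>k. u k / \<rho>)) UNIV \<le> (\<Sum>\<^sub>\<infinity>j. 1 / \<rho> * ?m u j)"
    by (intro infsum_mono sm' summable_on_cmult_right sm le)
  also have "\<dots> = 1 / \<rho> * infsum (?m u) UNIV"
    by (rule infsum_cmult_right) (use sm in simp)
  also have "\<dots> \<le> 1"
    using \<rho> by (simp add: \<rho>_def divide_le_eq)
  finally have "\<rho> \<in> N"
    using \<rho> sm' by (simp add: N_def)
  then obtain \<eta> where \<eta>: "\<eta> \<in> N" "\<eta> < R"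
    using cInf_lessD[of N R] norm norm_eq by auto
  have \<eta>0: "0 < \<eta>" using \<eta> by (simp add: N_def)
  have "\<beta> * \<bar>u k / \<eta>\<bar> powr p k \<le> ?m (\<lambda>k. u k / \<eta>) k"
    using \<beta>(3)[of k] a_pos[of k] mult_right_mono[of \<beta> "b k" "\<bar>u k / \<eta>\<bar> powr p k"]
    by (simp add: modular_term_def add.commute add_increasing2)
  also have "\<dots> \<le> infsum (?m (\<lambda>k. u k / \<eta>)) UNIV"
    using finite_sum_le_infsum[of "?m (\<lambda>k. u k / \<eta>)" UNIV "{k}"] \<eta>(1) modular_term_nonneg
    by (simp add: N_def)
  also have "\<dots> \<le> 1" using \<eta>(1) by (simp add: N_def)
  finally have bound: "\<bar>u k / \<eta>\<bar> powr p k \<le> 1 / \<beta>"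
    using \<beta>(1) by (simp add: field_simps)
  \<comment> \<open>Since \<open>1 / \<beta> \<ge> 1\<close>, a larger base would exceed 1, and its
    power with exponent \<open>p k > 1\<close> would be larger still.\<close>
  have "\<bar>u k / \<eta>\<bar> \<le> 1 / \<beta>"
  proof (rule ccontr)
    assume gt: "\<not> \<bar>u k / \<eta>\<bar> \<le> 1 / \<beta>"
    have "1 \<le> 1 / \<beta>" using \<beta> by simp
    with gt have "1 \<le> \<bar>u k / \<eta>\<bar>" by linarith
    then have "\<bar>u k / \<eta>\<bar> powr 1 \<le> \<bar>u k / \<eta>\<bar> powr p k"
      using p_gt_1[of k] by (intro powr_mono) auto
    with bound gt show False using \<open>1 \<le> \<bar>u k / \<eta>\<bar>\<close> by simp
  qed
  then have "\<bar>u k\<bar> \<le> \<eta> / \<beta>"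
    using \<eta>0 \<beta>(1) by (simp add: abs_divide field_simps)
  also have "\<dots> \<le> R / \<beta>"
    using \<eta>(2) \<beta>(1) by (simp add: divide_right_mono)
  finally show ?thesis .
qed

section \<open>The growth condition and spikes\<close>

text \<open>The common consequence of (F5) and (F6): a limsup above \<open>L\<close> is exceeded
  frequently, hence at arbitrarily large \<open>t\<close>. The gap \<open>L - 1 / p_inf p\<close> is
  the same for all \<open>R\<close>.\<close>

lemma growth_witness:
  assumes "cond_F5 p a b f \<or> cond_F6 p a b f"
  obtains L where "1 / p_inf p < L"
    "\<And>R. \<exists>k t. R \<le> t \<and> L < growth_quotient p a b f k t"
proof -
  note witness = that
  from assms show thesis
  proof
    assume F5: "cond_F5 p a b f"
    have *: thesis if lim: "ereal (1 / p_inf p) < Limsup (F \<times>\<^sub>F at_top) (\<lambda>(k, t). ereal (growth_quotient p a b f k t))"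
      for F :: "int filter"
    proof -
      obtain L where L: "1 / p_inf p < L"
        "ereal L < Limsup (F \<times>\<^sub>F at_top) (\<lambda>(k, t). ereal (growth_quotient p a b f k t))"
        using ereal_dense2[OF lim] by auto
      show thesis
      proof (rule witness[OF L(1)])
        fix R :: real
        have "eventually (\<lambda>(k :: int, t). R \<le> t) (F \<times>\<^sub>F at_top)"
          unfolding eventually_prod_filter
          by (intro exI[of _ "\<lambda>_. True"] exI[of _ "\<lambda>t. R \<le> t"]) (auto simp: eventually_ge_at_top)
        from frequently_eventually_frequently[OF frequently_gt_if_Limsup_gt[OF L(2)] this]
        show "\<exists>k t. R \<le> t \<and> L < growth_quotient p a b f k t"
          by (auto dest!: frequently_ex) blast
      qed
    qed
    show thesis
      using F5 *[of at_top] *[of at_bot] unfolding cond_F5_def by (auto simp: less_max_iff_disj)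
  next
    assume "cond_F6 p a b f"
    then obtain k where "ereal (1 / p_inf p) < Limsup at_top (\<lambda>t. ereal (growth_quotient p a b f k t))"
      unfolding cond_F6_def by (auto simp: less_SUP_iff)
    then obtain L where L: "1 / p_inf p < L"
      "ereal L < Limsup at_top (\<lambda>t. ereal (growth_quotient p a b f k t))"
      using ereal_dense2 by fastforce
    show thesis
    proof (rule witness[OF L(1)])
      fix R :: real
      from frequently_eventually_frequently[OF frequently_gt_if_Limsup_gt[OF L(2)] eventually_ge_at_top[of R]]
      show "\<exists>k t. R \<le> t \<and> L < growth_quotient p a b f k t"
        by (auto dest!: frequently_ex)
    qed
  qed
qed

text \<open>With \<open>s = a (k - 1) + a k + b k\<close>, the modular part is at most
  \<open>s * t powr p_sup p / p_inf p\<close> because \<open>t \<ge> 1\<close>, while the primitive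
  exceeds \<open>L * s * t powr p_sup p\<close>.\<close>

lemma spike_energy:
  assumes t: "1 \<le> t" and q: "1 / p_inf p < L" "L < growth_quotient p a b f k t"
    and \<beta>: "\<And>k. \<beta> \<le> b k" and d: "0 < d"
  defines "w \<equiv> (\<lambda>_. 0)(k := t)"
  shows "(\<lambda>j. energy_term d j w) summable_on UNIV"
    and "(\<Sum>\<^sub>\<infinity>j. energy_term d j w) \<le> (\<Sum>\<^sub>\<infinity>j. d * f_sup d j) - (L - 1 / p_inf p) * \<beta> * t"
proof -
  have sm0: "(\<lambda>j. energy_term d j (\<lambda>_. 0)) summable_on UNIV"
    using f_sup_summable[OF d] by (simp add: energy_term_0 summable_on_cmult_right)
  show "(\<lambda>j. energy_term d j w) summable_on UNIV"
    unfolding w_def by (rule energy_update(1)[OF sm0])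
  define s where "s = a (k - 1) + a k + b k"
  have s: "0 < s" "b k \<le> s"
    using a_pos[of "k - 1"] a_pos[of k] b_pos[of k] by (auto simp: s_def)
  have power: "t powr p j / p j \<le> t powr p_sup p / p_inf p" for j
    using t p_bounds[of j] p_inf_gt_1 by (intro frac_le powr_mono) auto
  have tp: "t \<le> t powr p_sup p"
    using t powr_mono[of 1 "p_sup p" t] p_bounds[of 0] p_inf_gt_1 by simp
  have "L * (s * t powr p_sup p) < primitive f k t"
    using q(2) s t by (simp add: growth_quotient_def s_def[symmetric] pos_less_divide_eq)
  moreover have "a (k - 1) * (t powr p (k - 1) / p (k - 1)) + a k * (t powr p k / p k) + b k * (t powr p k / p k)
      \<le> s * (t powr p_sup p / p_inf p)"
    unfolding s_def distrib_right
    by (intro add_mono mult_left_mono power less_imp_le a_pos b_pos)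
  ultimately have "a (k - 1) * (t powr p (k - 1) / p (k - 1)) + a k * (t powr p k / p k) + b k * (t powr p k / p k)
      - primitive f k t \<le> - ((L - 1 / p_inf p) * (s * t powr p_sup p))"
    by (simp add: algebra_simps)
  also have "\<dots> \<le> - ((L - 1 / p_inf p) * (\<beta> * t))"
  proof -
    have "\<beta> * t \<le> s * t powr p_sup p"
      using \<beta>[of k] s t tp by (intro mult_mono) auto
    then show ?thesis using q(1) by (simp add: mult_left_mono)
  qed
  finally have energy: "a (k - 1) * (t powr p (k - 1) / p (k - 1)) + a k * (t powr p k / p k)
      + b k * (t powr p k / p k) - primitive f k t \<le> - ((L - 1 / p_inf p) * (\<beta> * t))" .
  \<comment> \<open>The spike is the zero sequence with one coordinate changed, so the constants
    \<open>d * f_sup d\<close> of terms \<open>k - 1\<close> and \<open>k\<close> cancel.\<close>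
  have "(\<Sum>\<^sub>\<infinity>j. energy_term d j w) = (\<Sum>\<^sub>\<infinity>j. d * f_sup d j)
      + (energy_term d (k - 1) w + energy_term d k w) - (d * f_sup d (k - 1) + d * f_sup d k)"
    using energy_update(2)[OF sm0, of k t] by (simp add: energy_term_0 w_def)
  also have "\<dots> = (\<Sum>\<^sub>\<infinity>j. d * f_sup d j) + (a (k - 1) * (t powr p (k - 1) / p (k - 1))
      + a k * (t powr p k / p k) + b k * (t powr p k / p k) - primitive f k t)"
    using t by (simp add: energy_term_def modular_term_def nabla_plus_def w_def add_divide_distrib)
  finally show "(\<Sum>\<^sub>\<infinity>j. energy_term d j w) \<le> (\<Sum>\<^sub>\<infinity>j. d * f_sup d j) - (L - 1 / p_inf p) * \<beta> * t"
    using energy by simp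
qed

section \<open>Solutions of large norm\<close>

text \<open>The order of choices matters: \<open>T\<close> and \<open>C\<close> depend on
  \<open>R\<close> but not on the box, then \<open>t\<close> is taken large against
  \<open>C\<close>, and finally \<open>d \<ge> t\<close> so that the box contains the spike.\<close>

lemma positive_solution_of_large_norm:
  fixes D :: "real set"
  assumes D: "\<And>r. \<exists>d\<in>D. r \<le> d" "\<And>k d. d \<in> D \<Longrightarrow> f k d \<le> 0"
    and F: "cond_F5 p a b f \<or> cond_F6 p a b f"
  shows "\<exists>u. u \<in> spaceE p a b \<and> is_solution p a b f u \<and> (\<forall>k. 0 < u k) \<and> R \<le> normE p a b u"
proof -
  obtain \<beta> where \<beta>: "0 < \<beta>" "\<beta> \<le> 1" "\<And>k. \<beta> \<le> b k"
    using b_lower_bound by metis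
  obtain L where L: "1 / p_inf p < L" "\<And>R. \<exists>k t. R \<le> t \<and> L < growth_quotient p a b f k t"
    using growth_witness[OF F] by metis
  \<comment> \<open>The coordinate bound that a norm below \<open>max 1 R\<close> would imply; the
    maximum keeps \<open>T\<close> positive.\<close>
  define T where "T = max 1 R / \<beta>"
  define C where "C = (\<Sum>\<^sub>\<infinity>j. T * f_sup T j)"
  have T: "0 < T" using \<beta> by (simp add: T_def)
  have smT: "(\<lambda>j. T * f_sup T j) summable_on UNIV"
    by (intro summable_on_cmult_right f_sup_summable T)
  have C: "0 \<le> C"
    unfolding C_def using T f_sup_nonneg[of T] by (intro infsum_nonneg) auto
  define e where "e = (L - 1 / p_inf p) * \<beta>"
  have e: "0 < e" using L(1) \<beta>(1) by (simp add: e_def)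
  obtain k t where t: "max 1 ((C + 1) / e) \<le> t" "L < growth_quotient p a b f k t"
    using L(2) by metis
  have t1: "1 \<le> t" and te: "C < e * t"
    using t(1) e by (auto simp: pos_divide_le_eq mult.commute)
  obtain d where d: "d \<in> D" "t \<le> d" using D(1) by blast
  have d0: "0 < d" using d t1 by simp
  have smd: "(\<lambda>j. d * f_sup d j) summable_on UNIV"
    by (intro summable_on_cmult_right f_sup_summable d0)
  obtain u where u: "u \<in> order_box d" "(\<lambda>k. energy_term d k u) summable_on UNIV"
    and min: "\<And>v. v \<in> order_box d \<Longrightarrow> (\<lambda>k. energy_term d k v) summable_on UNIV \<Longrightarrow>
       (\<Sum>\<^sub>\<infinity>k. energy_term d k u) \<le> (\<Sum>\<^sub>\<infinity>k. energy_term d k v)"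
    using energy_minimizer[OF d0] by metis
  note spike = spike_energy[OF t1 L(1) t(2) \<beta>(3) d0]
  have "(\<lambda>_. 0)(k := t) \<in> order_box d"
    using t1 d d0 by (simp add: mem_order_box_iff)
  from min[OF this spike(1)] spike(2) te
  have low: "(\<Sum>\<^sub>\<infinity>k. energy_term d k u) < (\<Sum>\<^sub>\<infinity>j. d * f_sup d j) - C"
    by (simp add: e_def)
  \<comment> \<open>The zero sequence has energy exactly \<open>\<Sum>j. d * f_sup d j\<close>,
    which exceeds the minimum.\<close>
  have "u \<noteq> (\<lambda>_. 0)"
    using low C by (auto simp: energy_term_0)
  with energy_minimizer_cases[OF d0 D(2)[OF d(1)] u min]
  have pos: "\<forall>k. 0 < u k" and res: "\<forall>k. residual u k = 0" by auto
  have E: "u \<in> spaceE p a b"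
    using u by (rule finite_energy_imp_spaceE)
  then have "(u \<longlongrightarrow> 0) abs_at_top"
    by (intro lp_var_tendsto_0) (simp add: spaceE_def)
  with res have sol: "is_solution p a b f u"
    by (simp add: is_solution_def residual_def)
  have "R \<le> normE p a b u"
  proof (rule ccontr)
    assume "\<not> R \<le> normE p a b u"
    then have "normE p a b u < max 1 R" by simp
    from normE_less_imp_coordinate_bound[OF E this \<beta>]
    have uT: "u j \<le> T" for j
      unfolding T_def by (rule abs_le_D1)
    \<comment> \<open>With coordinates at most \<open>T\<close>, the primitives lower the energy by
      at most \<open>C\<close> in total, whatever \<open>d\<close> is; this contradicts
      \<open>low\<close>.\<close>
    have "d * f_sup d j \<le> energy_term d j u + T * f_sup T j" for j
      using primitive_le[OF _ uT, of j] pos modular_term_nonneg[of u j] p_pos[of j]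
      by (simp add: energy_term_def less_imp_le add_increasing)
    then have "(\<Sum>\<^sub>\<infinity>j. d * f_sup d j) \<le> (\<Sum>\<^sub>\<infinity>j. energy_term d j u + T * f_sup T j)"
      by (intro infsum_mono summable_on_add smd smT u)
    also have "\<dots> = (\<Sum>\<^sub>\<infinity>j. energy_term d j u) + C"
      unfolding C_def by (intro infsum_add u smT)
    finally show False
      using low by simp
  qed
  with E sol pos show ?thesis by blast
qed

end

theorem theorem1:
  fixes p a b :: "int \<Rightarrow> real" and f :: "int \<Rightarrow> real \<Rightarrow> real"
  assumes p_bdd: "bdd_below (range p)" "bdd_above (range p)"
    and p_gt_1: "1 < p_inf p"
    and a_pos: "\<And>k. 0 < a k"
    and b_pos: "\<And>k. 0 < b k"
    and f_cont: "\<And>k. continuous_on UNIV (f k)"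
    and A: "filterlim b at_top abs_at_top"
    and F1: "\<And>k. f k 0 = 0"
    and F2: "\<And>T. T > 0 \<Longrightarrow> (\<lambda>k. SUP t\<in>{t. \<bar>t\<bar> \<le> T}. \<bar>f k t\<bar>) summable_on UNIV"
    and F3: "\<exists>c d :: nat \<Rightarrow> real.
               (\<forall>n. 0 < c n \<and> c n < d n \<and> d n < c (Suc n)) \<and>
               filterlim c at_top sequentially \<and>
               (\<forall>k n. \<forall>t\<in>{c n..d n}. f k t \<le> 0)"
    and F5_or_F6: "cond_F5 p a b f \<or> cond_F6 p a b f"
  shows "\<exists>u :: nat \<Rightarrow> int \<Rightarrow> real.
           (\<forall>n. u n \<in> spaceE p a b \<and> is_solution p a b f (u n) \<and> (\<forall>k. u n k > 0)) \<and>
           filterlim (\<lambda>n. normE p a b (u n)) at_top sequentially"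
proof -
  interpret anisotropic_difference_problem p a b f
    by unfold_locales fact+
  obtain c d :: "nat \<Rightarrow> real" where cd: "\<And>n. 0 < c n \<and> c n < d n \<and> d n < c (Suc n)"
    "filterlim c at_top sequentially" "\<And>k n t. t \<in> {c n..d n} \<Longrightarrow> f k t \<le> 0"
    using F3 by metis
  \<comment> \<open>The right endpoints \<open>d n\<close> serve as the sizes of the boxes.\<close>
  have unbounded: "\<exists>x\<in>range d. r \<le> x" for r
  proof -
    obtain n where "r \<le> c n"
      using cd(2) unfolding filterlim_at_top eventually_sequentially by blast
    then show ?thesis using cd(1)[of n] by (intro bexI[of _ "d n"]) auto
  qed
  have "f k (d n) \<le> 0" for k n
    using cd(1)[of n] by (intro cd(3)[of _ n]) auto
  then have nonpos: "f k x \<le> 0" if "x \<in> range d" for k x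
    using that by auto
  have "\<exists>u. u \<in> spaceE p a b \<and> is_solution p a b f u \<and> (\<forall>k. 0 < u k)
      \<and> R \<le> normE p a b u" for R
    using unbounded nonpos F5_or_F6 by (rule positive_solution_of_large_norm)
  then have "\<forall>n :: nat. \<exists>u. u \<in> spaceE p a b \<and> is_solution p a b f u \<and> (\<forall>k. 0 < u k)
      \<and> real n \<le> normE p a b u"
    by blast
  from choice[OF this] obtain u :: "nat \<Rightarrow> int \<Rightarrow> real"
    where u: "\<And>n. u n \<in> spaceE p a b \<and> is_solution p a b f (u n) \<and> (\<forall>k. 0 < u n k)
        \<and> real n \<le> normE p a b (u n)"
    by blast
  have "filterlim (\<lambda>n. normE p a b (u n)) at_top sequentially"
    using u by (intro filterlim_at_top_mono[OF filterlim_real_sequentially]) auto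
  with u show ?thesis by blast
qed

end
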